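(* Let $M\subset\mathbb{Q}$ and $f,g\colon M\to\mathbb{R}$ be functions such that (i) $f$ and $g$ are bounded, (ii) one of $f,g$ is uniformly continuous and the other has bounded derivative (on its domain of differentiability), and (iii) $f'$ is uniform on $D(f)$ and $g'$ is uniform on $D(g)$. Then $D(f)\cap D(g)\subset D(fg)$, and on $D(f)\cap D(g)$ the derivative of $fg$ equals $f'g+fg'$ and is uniform on $D(f)\cap D(g)$.
   Context: $fg$ is the pointwise product. A function $h\colon M\to\mathbb{R}$ is uniformly continuous if for every $k\in\mathbb{N}$ there is $l$ with $a,b\in M$, $|a-b|\le1/l\Rightarrow|h(a)-h(b)|\le1/k$. A rational $a\in M$ is a limit point of $M$ if for every $k$ there is $b\in M$ with $0<|a-b|\le1/k$. For such $a$, $h'(a)=y\in\mathbb{R}$ if for every $k$ there is $l$ with $b\in M$, $0<|a-b|\le1/l\Rightarrow|\frac{h(b)-h(a)}{b-a}-y|\le1/k$. $D(h)$ is the set of limit points $a\in M$ of $M$ where $h'(a)$ exists. The derivative of $h$ is uniform on a set $N\subset D(h)$ if for every $k$ there is $l$ such that for all $a\in N$ and $b\in M$ with $0<|a-b|\le1/l$: $|\frac{h(b)-h(a)}{b-a}-h'(a)|\le1/k$. *)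

theory Defs
  imports "HOL-Analysis.Analysis"
begin

text \<open>
  A function \<open>h : M \<rightarrow> \<real>\<close> with \<open>M \<subseteq> \<rat>\<close> is a total function \<open>h :: rat \<Rightarrow> real\<close>
  together with \<open>M\<close>; only the values of \<open>h\<close> on \<open>M\<close> enter the definitions below.
  The libraries provide no topology on \<^typ>\<open>rat\<close>, hence the explicit definitions.
  Indices \<open>k\<close>, \<open>l\<close> with \<open>1 / k\<close>, \<open>1 / l\<close> range over the positive naturals, since \<open>1 / 0 = 0\<close> in HOL.
\<close>

definition unif_cont_on :: "rat set \<Rightarrow> (rat \<Rightarrow> real) \<Rightarrow> bool" where
  "unif_cont_on M h \<longleftrightarrow>
    (\<forall>k::nat. k > 0 \<longrightarrow> (\<exists>l::nat. l > 0 \<and>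
      (\<forall>a\<in>M. \<forall>b\<in>M. \<bar>a - b\<bar> \<le> 1 / of_nat l \<longrightarrow> \<bar>h a - h b\<bar> \<le> 1 / real k)))"

definition limit_point :: "rat set \<Rightarrow> rat \<Rightarrow> bool" where
  "limit_point M a \<longleftrightarrow>
    (\<forall>k::nat. k > 0 \<longrightarrow> (\<exists>b\<in>M. 0 < \<bar>a - b\<bar> \<and> \<bar>a - b\<bar> \<le> 1 / of_nat k))"

definition diff_quot :: "(rat \<Rightarrow> real) \<Rightarrow> rat \<Rightarrow> rat \<Rightarrow> real" where
  "diff_quot h a b = (h b - h a) / of_rat (b - a)"

definition has_deriv_at :: "rat set \<Rightarrow> (rat \<Rightarrow> real) \<Rightarrow> rat \<Rightarrow> real \<Rightarrow> bool" where
  "has_deriv_at M h a y \<longleftrightarrow> a \<in> M \<and> limit_point M a \<and>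
    (\<forall>k::nat. k > 0 \<longrightarrow> (\<exists>l::nat. l > 0 \<and>
      (\<forall>b\<in>M. 0 < \<bar>a - b\<bar> \<and> \<bar>a - b\<bar> \<le> 1 / of_nat l \<longrightarrow> \<bar>diff_quot h a b - y\<bar> \<le> 1 / real k)))"

definition diff_dom :: "rat set \<Rightarrow> (rat \<Rightarrow> real) \<Rightarrow> rat set" where
  "diff_dom M h = {a. \<exists>y. has_deriv_at M h a y}"

text \<open>Meaningful on \<open>diff_dom M h\<close> only, where the value is unique (\<open>has_deriv_at_unique\<close> below).\<close>

definition derivative :: "rat set \<Rightarrow> (rat \<Rightarrow> real) \<Rightarrow> rat \<Rightarrow> real" where
  "derivative M h a = (THE y. has_deriv_at M h a y)"

definition uniform_derivative_on :: "rat set \<Rightarrow> (rat \<Rightarrow> real) \<Rightarrow> rat set \<Rightarrow> bool" where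
  "uniform_derivative_on M h N \<longleftrightarrow> N \<subseteq> diff_dom M h \<and>
    (\<forall>k::nat. k > 0 \<longrightarrow> (\<exists>l::nat. l > 0 \<and>
      (\<forall>a\<in>N. \<forall>b\<in>M. 0 < \<bar>a - b\<bar> \<and> \<bar>a - b\<bar> \<le> 1 / of_nat l \<longrightarrow>
        \<bar>diff_quot h a b - derivative M h a\<bar> \<le> 1 / real k)))"

lemma has_deriv_at_unique:
  assumes "has_deriv_at M h a y" and "has_deriv_at M h a z"
  shows "y = z"
proof (rule ccontr)
  assume "y \<noteq> z"
  then obtain n where n: "inverse (real (Suc n)) < \<bar>y - z\<bar> / 2"
    using reals_Archimedean[of "\<bar>y - z\<bar> / 2"] by auto
  obtain l where l: "l > 0" "\<forall>b\<in>M. 0 < \<bar>a - b\<bar> \<and> \<bar>a - b\<bar> \<le> 1 / of_nat l \<longrightarrow>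
      \<bar>diff_quot h a b - y\<bar> \<le> 1 / real (Suc n)"
    using assms(1) unfolding has_deriv_at_def by (meson zero_less_Suc)
  obtain m where m: "m > 0" "\<forall>b\<in>M. 0 < \<bar>a - b\<bar> \<and> \<bar>a - b\<bar> \<le> 1 / of_nat m \<longrightarrow>
      \<bar>diff_quot h a b - z\<bar> \<le> 1 / real (Suc n)"
    using assms(2) unfolding has_deriv_at_def by (meson zero_less_Suc)
  obtain b where b: "b \<in> M" "0 < \<bar>a - b\<bar>" "\<bar>a - b\<bar> \<le> 1 / of_nat (max l m)"
    using assms(1) l(1) unfolding has_deriv_at_def limit_point_def
    by (meson less_max_iff_disj)
  have "1 / of_nat (max l m) \<le> (1 / of_nat l :: rat)" "1 / of_nat (max l m) \<le> (1 / of_nat m :: rat)"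
    using l(1) m(1) by (auto intro!: divide_left_mono simp del: of_nat_max)
  then have "\<bar>a - b\<bar> \<le> 1 / of_nat l" "\<bar>a - b\<bar> \<le> 1 / of_nat m"
    using b(3) by linarith+
  then have "\<bar>diff_quot h a b - y\<bar> \<le> 1 / real (Suc n)" "\<bar>diff_quot h a b - z\<bar> \<le> 1 / real (Suc n)"
    using l(2) m(2) b by blast+
  moreover have "\<bar>y - z\<bar> \<le> \<bar>diff_quot h a b - y\<bar> + \<bar>diff_quot h a b - z\<bar>"
    by linarith
  ultimately show False
    using n unfolding inverse_eq_divide by argo
qed

lemma derivative_eqI: "has_deriv_at M h a y \<Longrightarrow> derivative M h a = y"
  unfolding derivative_def by (blast intro: has_deriv_at_unique)

end

theory Submission
  imports Defs
begin

text \<open>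
  The difference quotient of the product differs from \<open>f' g + f g'\<close> at \<open>a\<close> by
  \<open>f b * (q - g' a) + (f b - f a) * g' a + g a * (p - f' a)\<close>, where \<open>p\<close>, \<open>q\<close> are the
  difference quotients of \<open>f\<close>, \<open>g\<close> between \<open>a\<close> and \<open>b\<close>. If \<open>f\<close> is uniformly continuous and \<open>g'\<close>
  bounded, each summand is a bounded factor times one that is uniformly small in \<open>a\<close>;
  the other alternative follows by exchanging \<open>f\<close> and \<open>g\<close>.
\<close>

lemma uniform_derivative_on_subset:
  assumes "uniform_derivative_on M h N" and "N' \<subseteq> N"
  shows "uniform_derivative_on M h N'"
  using assms unfolding uniform_derivative_on_def by (meson subset_iff)

text \<open>Since \<open>derivative\<close> is a definite description, it can be evaluated only once
  existence of the derivative is known. So the estimate is made against an explicit candidate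
  \<open>D\<close>: at each single point of \<open>N\<close> it gives differentiability, uniqueness
  then identifies \<open>D\<close> with the derivative, and the same estimate becomes the uniformity
  claim.\<close>

lemma uniform_derivative_onI:
  assumes N: "N \<subseteq> M" "\<And>a. a \<in> N \<Longrightarrow> limit_point M a"
    and D: "\<And>k. k > 0 \<Longrightarrow> \<exists>l::nat. l > 0 \<and> (\<forall>a\<in>N. \<forall>b\<in>M.
      0 < \<bar>a - b\<bar> \<and> \<bar>a - b\<bar> \<le> 1 / of_nat l \<longrightarrow> \<bar>diff_quot h a b - D a\<bar> \<le> 1 / real k)"
  shows "uniform_derivative_on M h N" and "a \<in> N \<Longrightarrow> derivative M h a = D a"
proof -
  have deriv: "has_deriv_at M h a (D a)" if "a \<in> N" for a
    unfolding has_deriv_at_def using that N D by (meson subsetD)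
  then show eq: "derivative M h a = D a" if "a \<in> N" for a
    using that by (blast intro: derivative_eqI)
  have "N \<subseteq> diff_dom M h"
    using deriv unfolding diff_dom_def by blast
  then show "uniform_derivative_on M h N"
    unfolding uniform_derivative_on_def using D by (simp add: eq)
qed

lemma bounded_image_nat_bound:
  fixes h :: "'a \<Rightarrow> real"
  assumes "bounded (h ` S)"
  obtains B :: nat where "\<And>x. x \<in> S \<Longrightarrow> \<bar>h x\<bar> \<le> real B"
proof -
  obtain c where c: "\<And>x. x \<in> S \<Longrightarrow> \<bar>h x\<bar> \<le> c"
    using assms unfolding bounded_iff by auto
  obtain B :: nat where "c \<le> real B"
    using real_arch_simple by blast
  then show ?thesis
    using c that by (meson order_trans)
qed

text \<open>Taking \<open>f\<close> at \<open>b\<close> but \<open>g\<close> at \<open>a\<close>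
  leaves only the increment of \<open>f\<close> uncontrolled by difference quotients, and it is
  multiplied by \<open>g'\<close>. Here \<open>f'\<close> and \<open>g'\<close> are arbitrary reals.
  The case \<open>a = b\<close> needs no exception, as division by zero yields 0.\<close>

lemma diff_quot_mult:
  "diff_quot (\<lambda>x. f x * g x) a b - (f' * g a + f a * g') =
    f b * (diff_quot g a b - g') + (f b - f a) * g' + g a * (diff_quot f a b - f')"
proof -
  have "f b * g b - f a * g a = f b * (g b - g a) + g a * (f b - f a)"
    by (simp add: algebra_simps)
  then have "diff_quot (\<lambda>x. f x * g x) a b = f b * diff_quot g a b + g a * diff_quot f a b"
    unfolding diff_quot_def by (simp add: add_divide_distrib)
  then show ?thesis
    by (simp add: algebra_simps)
qed

lemma uniform_derivative_on_mult:
  assumes f: "bounded (f ` M)" and g: "bounded (g ` M)" and cont: "unif_cont_on M f"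
    and bdd: "bounded (derivative M g ` N)"
    and uf: "uniform_derivative_on M f N" and ug: "uniform_derivative_on M g N"
  shows "uniform_derivative_on M (\<lambda>x. f x * g x) N"
    and "a \<in> N \<Longrightarrow> derivative M (\<lambda>x. f x * g x) a = derivative M f a * g a + f a * derivative M g a"
proof -
  obtain B1 :: nat where B1: "\<And>x. x \<in> M \<Longrightarrow> \<bar>f x\<bar> \<le> real B1"
    using bounded_image_nat_bound[OF f] by blast
  obtain B2 :: nat where B2: "\<And>x. x \<in> M \<Longrightarrow> \<bar>g x\<bar> \<le> real B2"
    using bounded_image_nat_bound[OF g] by blast
  obtain B3 :: nat where B3: "\<And>x. x \<in> N \<Longrightarrow> \<bar>derivative M g x\<bar> \<le> real B3"
    using bounded_image_nat_bound[OF bdd] by blast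
  \<comment> \<open>One common bound for \<open>f\<close>, \<open>g\<close> and the derivative of
    \<open>g\<close>; the successor makes it positive, so that \<open>m\<close> below is a
    legitimate index.\<close>
  define B where "B = Suc (B1 + B2 + B3)"
  have NM: "a \<in> M" "limit_point M a" if "a \<in> N" for a
    using uf that unfolding uniform_derivative_on_def diff_dom_def has_deriv_at_def by auto
  have est: "\<exists>l::nat. l > 0 \<and> (\<forall>a\<in>N. \<forall>b\<in>M. 0 < \<bar>a - b\<bar> \<and> \<bar>a - b\<bar> \<le> 1 / of_nat l \<longrightarrow>
      \<bar>diff_quot (\<lambda>x. f x * g x) a b - (derivative M f a * g a + f a * derivative M g a)\<bar>
        \<le> 1 / real k)" if "k > 0" for k
  proof -
    \<comment> \<open>Each of the three summands will be at most B/m, and 3B/m = 1/k. This is why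
      the bounds were taken in the naturals.\<close>
    define m where "m = 3 * B * k"
    have m: "m > 0"
      using that by (simp add: m_def B_def)
    obtain l1 where l1: "l1 > 0" "\<And>a b. a \<in> N \<Longrightarrow> b \<in> M \<Longrightarrow> 0 < \<bar>a - b\<bar> \<Longrightarrow> \<bar>a - b\<bar> \<le> 1 / of_nat l1
        \<Longrightarrow> \<bar>diff_quot f a b - derivative M f a\<bar> \<le> 1 / real m"
      using uf m unfolding uniform_derivative_on_def by meson
    obtain l2 where l2: "l2 > 0" "\<And>a b. a \<in> N \<Longrightarrow> b \<in> M \<Longrightarrow> 0 < \<bar>a - b\<bar> \<Longrightarrow> \<bar>a - b\<bar> \<le> 1 / of_nat l2
        \<Longrightarrow> \<bar>diff_quot g a b - derivative M g a\<bar> \<le> 1 / real m"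
      using ug m unfolding uniform_derivative_on_def by meson
    obtain l3 where l3: "l3 > 0" "\<And>a b. a \<in> M \<Longrightarrow> b \<in> M \<Longrightarrow> \<bar>a - b\<bar> \<le> 1 / of_nat l3
        \<Longrightarrow> \<bar>f a - f b\<bar> \<le> 1 / real m"
      using cont m unfolding unif_cont_on_def by meson
    \<comment> \<open>The sum dominates each of the three indices, so being within 1/l activates all
      three estimates.\<close>
    define l where "l = l1 + l2 + l3"
    have le: "1 / of_nat l \<le> (1 / of_nat i :: rat)" if "i > 0" "i \<le> l" for i
      using that by (intro divide_left_mono) auto
    have "\<bar>diff_quot (\<lambda>x. f x * g x) a b - (derivative M f a * g a + f a * derivative M g a)\<bar>
        \<le> 1 / real k" if ab: "a \<in> N" "b \<in> M" "0 < \<bar>a - b\<bar>" "\<bar>a - b\<bar> \<le> 1 / of_nat l" for a b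
    proof -
      have "\<bar>a - b\<bar> \<le> 1 / of_nat l1" "\<bar>a - b\<bar> \<le> 1 / of_nat l2" "\<bar>a - b\<bar> \<le> 1 / of_nat l3"
        using ab(4) le[of l1] le[of l2] le[of l3] l1(1) l2(1) l3(1) by (auto simp: l_def)
      then have small: "\<bar>diff_quot f a b - derivative M f a\<bar> \<le> 1 / real m"
          "\<bar>diff_quot g a b - derivative M g a\<bar> \<le> 1 / real m" "\<bar>f b - f a\<bar> \<le> 1 / real m"
        using l1(2) l2(2) l3(2)[of a b] ab NM(1) by (auto simp: abs_minus_commute)
      have "\<bar>f b\<bar> \<le> B" "\<bar>g a\<bar> \<le> B" "\<bar>derivative M g a\<bar> \<le> B"
        using B1[of b] B2[of a] B3[of a] ab NM(1)[of a] by (auto simp: B_def)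
      then have "\<bar>f b * (diff_quot g a b - derivative M g a)\<bar> \<le> B * (1 / m)"
          "\<bar>derivative M g a * (f b - f a)\<bar> \<le> B * (1 / m)"
          "\<bar>g a * (diff_quot f a b - derivative M f a)\<bar> \<le> B * (1 / m)"
        unfolding abs_mult using small by (intro mult_mono; simp)+
      moreover have triangle: "\<bar>x + y + z\<bar> \<le> 3 * c" if "\<bar>x\<bar> \<le> c" "\<bar>y\<bar> \<le> c" "\<bar>z\<bar> \<le> c"
        for x y z c :: real
        using that by linarith
      ultimately have "\<bar>diff_quot (\<lambda>x. f x * g x) a b - (derivative M f a * g a + f a * derivative M g a)\<bar>
          \<le> 3 * (B * (1 / m))"
        unfolding diff_quot_mult by (intro triangle) (simp_all add: mult.commute)
      also have "\<dots> = 1 / k"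
        using m by (simp add: m_def)
      finally show ?thesis .
    qed
    moreover have "l > 0"
      using l1(1) by (simp add: l_def)
    ultimately show ?thesis by blast
  qed
  have sub: "N \<subseteq> M"
    using NM(1) by blast
  show "uniform_derivative_on M (\<lambda>x. f x * g x) N"
    by (rule uniform_derivative_onI(1)[OF sub NM(2) est])
  show "derivative M (\<lambda>x. f x * g x) a = derivative M f a * g a + f a * derivative M g a"
    if "a \<in> N"
    by (rule uniform_derivative_onI(2)[OF sub NM(2) est that])
qed

theorem theorem2p42:
  fixes M :: "rat set" and f g :: "rat \<Rightarrow> real"
  assumes "bounded (f ` M)" and "bounded (g ` M)"
    and "unif_cont_on M f \<and> bounded (derivative M g ` diff_dom M g) \<or>
         unif_cont_on M g \<and> bounded (derivative M f ` diff_dom M f)"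
    and "uniform_derivative_on M f (diff_dom M f)"
    and "uniform_derivative_on M g (diff_dom M g)"
  shows "diff_dom M f \<inter> diff_dom M g \<subseteq> diff_dom M (\<lambda>x. f x * g x) \<and>
    (\<forall>a \<in> diff_dom M f \<inter> diff_dom M g.
      derivative M (\<lambda>x. f x * g x) a = derivative M f a * g a + f a * derivative M g a) \<and>
    uniform_derivative_on M (\<lambda>x. f x * g x) (diff_dom M f \<inter> diff_dom M g)"
proof -
  let ?N = "diff_dom M f \<inter> diff_dom M g"
  have uf: "uniform_derivative_on M f ?N" and ug: "uniform_derivative_on M g ?N"
    using assms(4,5) by (auto intro: uniform_derivative_on_subset)
  have "uniform_derivative_on M (\<lambda>x. f x * g x) ?N \<and>
    (\<forall>a\<in>?N. derivative M (\<lambda>x. f x * g x) a = derivative M f a * g a + f a * derivative M g a)"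
    using assms(3)
  proof
    assume A: "unif_cont_on M f \<and> bounded (derivative M g ` diff_dom M g)"
    then have "bounded (derivative M g ` ?N)"
      by (auto intro: bounded_subset)
    with A show ?thesis
      using uniform_derivative_on_mult[OF assms(1,2) _ _ uf ug] by blast
  next
    assume A: "unif_cont_on M g \<and> bounded (derivative M f ` diff_dom M f)"
    then have "bounded (derivative M f ` ?N)"
      by (auto intro: bounded_subset)
    \<comment> \<open>Both the product and the product rule are symmetric in \<open>f\<close> and
      \<open>g\<close>, so the exchanged version only has to be rewritten by commutativity.\<close>
    with A have "uniform_derivative_on M (\<lambda>x. g x * f x) ?N \<and>
      (\<forall>a\<in>?N. derivative M (\<lambda>x. g x * f x) a = derivative M g a * f a + g a * derivative M f a)"
      using uniform_derivative_on_mult[OF assms(2,1) _ _ ug uf] by blast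
    then show ?thesis
      by (simp add: mult.commute add.commute)
  qed
  \<comment> \<open>The inclusion of domains is the first conjunct of
    \<open>uniform_derivative_on\<close>.\<close>
  then show ?thesis
    unfolding uniform_derivative_on_def by blast
qed

end
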